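(* Let $A_n:=|\mathsf{Div}(\Delta_n)|$ for $n\geq 0$. Let $n\ge 2$. Then $$A_n=2A_0+2A_{n-1}+\sum_{i=1}^{n-2}A_i.$$ It follows that $A_n=F_{2n}$.
   Context: $M_0$ is the trivial monoid with $\Delta_0=1$. For $n\ge 1$, let $M_n$ be the monoid with presentation $\langle \rho_1,\dots,\rho_n \mid \rho_1\rho_n\rho_i=\rho_{i+1}\rho_n \text{ for all } 1\le i\le n-1\rangle$, and let $\Delta_n:=\rho_n^{n+1}$. $\mathsf{Div}(\Delta_n)$ is the finite set of left divisors of $\Delta_n$ in $M_n$, i.e. of $a\in M_n$ such that $ac=\Delta_n$ for some $c\in M_n$ (it coincides with the set of right divisors). The Fibonacci sequence is indexed here by $F_0=1$, $F_1=2$, $F_i=F_{i-1}+F_{i-2}$ for $i\ge 2$ (so $1,2,3,5,8,\dots$). *)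

theory Defs
  imports "HOL-Algebra.Divisibility"
begin

inductive_set word_cong :: "'a set \<Rightarrow> ('a list \<times> 'a list) set \<Rightarrow> ('a list \<times> 'a list) set"
  for X :: "'a set" and R :: "('a list \<times> 'a list) set" where
  refl: "w \<in> lists X \<Longrightarrow> (w, w) \<in> word_cong X R"
| sym: "(u, v) \<in> word_cong X R \<Longrightarrow> (v, u) \<in> word_cong X R"
| trans: "(u, v) \<in> word_cong X R \<Longrightarrow> (v, w) \<in> word_cong X R \<Longrightarrow> (u, w) \<in> word_cong X R"
| rel: "(u, v) \<in> R \<Longrightarrow> u \<in> lists X \<Longrightarrow> v \<in> lists X \<Longrightarrow> p \<in> lists X \<Longrightarrow> q \<in> lists X
    \<Longrightarrow> (p @ u @ q, p @ v @ q) \<in> word_cong X R"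

definition presented_monoid :: "'a set \<Rightarrow> ('a list \<times> 'a list) set \<Rightarrow> 'a list set monoid" where
  "presented_monoid X R =
    \<lparr> carrier = lists X // word_cong X R,
      mult = (\<lambda>a b. \<Union>u\<in>a. \<Union>v\<in>b. word_cong X R `` {u @ v}),
      one = word_cong X R `` {[]} \<rparr>"

lemma word_cong_lists: "(u, v) \<in> word_cong X R \<Longrightarrow> u \<in> lists X \<and> v \<in> lists X"
  by (induction rule: word_cong.induct) auto

lemma equiv_word_cong: "equiv (lists X) (word_cong X R)"
proof (rule equivI)
  show "word_cong X R \<subseteq> lists X \<times> lists X"
    using word_cong_lists by fast
  show "refl_on (lists X) (word_cong X R)"
    by (auto simp: refl_on_def intro: word_cong.refl)
  show "Relation.sym (word_cong X R)"
    by (auto simp: sym_def intro: word_cong.sym)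
  show "Relation.trans (word_cong X R)"
    by (auto simp: trans_def intro: word_cong.trans)
qed

lemma word_cong_context:
  assumes "(u, v) \<in> word_cong X R" "p \<in> lists X" "q \<in> lists X"
  shows "(p @ u @ q, p @ v @ q) \<in> word_cong X R"
  using assms
proof (induction rule: word_cong.induct)
  case (rel u v p' q')
  then have "((p @ p') @ u @ (q' @ q), (p @ p') @ v @ (q' @ q)) \<in> word_cong X R"
    by (intro word_cong.rel) auto
  then show ?case by simp
next
  case (refl w)
  then show ?case by (intro word_cong.refl) auto
qed (blast intro: word_cong.sym word_cong.trans)+

lemma word_cong_append:
  assumes "(u, u') \<in> word_cong X R" "(v, v') \<in> word_cong X R"
  shows "(u @ v, u' @ v') \<in> word_cong X R"
  using word_cong_context[OF assms(1), of "[]" v] word_cong_context[OF assms(2), of u' "[]"]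
    word_cong_lists[OF assms(1)] word_cong_lists[OF assms(2)]
  by (auto intro: word_cong.trans)

lemma presented_monoid_mult:
  assumes "u \<in> lists X" "v \<in> lists X"
  shows "word_cong X R `` {u} \<otimes>\<^bsub>presented_monoid X R\<^esub> word_cong X R `` {v}
    = word_cong X R `` {u @ v}"
proof -
  have "congruent2 (word_cong X R) (word_cong X R) (\<lambda>u v. word_cong X R `` {u @ v})"
    by (auto simp: congruent2_def intro!: equiv_class_eq[OF equiv_word_cong] word_cong_append)
  from UN_equiv_class2[OF equiv_word_cong equiv_word_cong this assms]
  show ?thesis by (simp add: presented_monoid_def)
qed

lemma monoid_presented_monoid: "monoid (presented_monoid X R)"
proof -
  let ?G = "presented_monoid X R" and ?c = "\<lambda>u. word_cong X R `` {u}"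
  have one: "\<one>\<^bsub>?G\<^esub> = ?c []"
    by (simp add: presented_monoid_def)
  have clI: "?c u \<in> carrier ?G" if "u \<in> lists X" for u
    using that by (simp add: presented_monoid_def quotientI)
  have clE: "\<exists>u\<in>lists X. x = ?c u" if "x \<in> carrier ?G" for x
    using that by (auto simp: presented_monoid_def quotient_def)
  show ?thesis
  proof (rule Group.monoidI)
    fix x y assume "x \<in> carrier ?G" "y \<in> carrier ?G"
    then obtain u v where *: "u \<in> lists X" "v \<in> lists X" "x = ?c u" "y = ?c v"
      using clE by blast
    then show "x \<otimes>\<^bsub>?G\<^esub> y \<in> carrier ?G"
      using clI[of "u @ v"] presented_monoid_mult[of u X v R] by simp
    fix z assume "z \<in> carrier ?G"
    then obtain w where "w \<in> lists X" "z = ?c w"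
      using clE by blast
    with * show "x \<otimes>\<^bsub>?G\<^esub> y \<otimes>\<^bsub>?G\<^esub> z = x \<otimes>\<^bsub>?G\<^esub> (y \<otimes>\<^bsub>?G\<^esub> z)"
      using presented_monoid_mult[of u X v R] presented_monoid_mult[of v X w R]
        presented_monoid_mult[of "u @ v" X w R] presented_monoid_mult[of u X "v @ w" R]
      by simp
  next
    show "\<one>\<^bsub>?G\<^esub> \<in> carrier ?G"
      using clI[of "[]"] one by simp
  next
    fix x assume "x \<in> carrier ?G"
    then obtain u where "u \<in> lists X" "x = ?c u"
      using clE by blast
    then show "\<one>\<^bsub>?G\<^esub> \<otimes>\<^bsub>?G\<^esub> x = x" "x \<otimes>\<^bsub>?G\<^esub> \<one>\<^bsub>?G\<^esub> = x"
      using presented_monoid_mult[of "[]" X u R] presented_monoid_mult[of u X "[]" R] one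
      by simp_all
  qed
qed

definition rho_rels :: "nat \<Rightarrow> (nat list \<times> nat list) set" where
  "rho_rels n = {([1, n, i], [i + 1, n]) | i. 1 \<le> i \<and> i < n}"

(* For n = 0 there are no generators, so this is the trivial monoid. *)
definition M :: "nat \<Rightarrow> nat list set monoid" where
  "M n = presented_monoid {1..n} (rho_rels n)"

definition rho :: "nat \<Rightarrow> nat \<Rightarrow> nat list set" where
  "rho n i = word_cong {1..n} (rho_rels n) `` {[i]}"

definition Delta :: "nat \<Rightarrow> nat list set" where
  "Delta n = (if n = 0 then \<one>\<^bsub>M n\<^esub> else rho n n [^]\<^bsub>M n\<^esub> (n + 1))"

(* The library relation a divides b means b = a * c for some c in the carrier; in these
   noncommutative monoids this is left divisibility. *)
definition Div_Delta :: "nat \<Rightarrow> nat list set set" where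
  "Div_Delta n = {a \<in> carrier (M n). a divides\<^bsub>M n\<^esub> Delta n}"

definition A :: "nat \<Rightarrow> nat" where
  "A n = card (Div_Delta n)"

(* Indexed as 1, 2, 3, 5, ..., so F n is the library's fib (n + 2). *)
fun F :: "nat \<Rightarrow> nat" where
  "F 0 = 1"
| "F (Suc 0) = 2"
| "F (Suc (Suc i)) = F (Suc i) + F i"

end

theory Submission
  imports Defs
begin

text \<open>Every divisor of \<open>\<Delta>\<^sub>n\<close> has a unique normal word, read by an automaton that starts in state
  \<open>n + 1\<close>: the letter \<open>n\<close> lowers a positive state by one, and a letter \<open>i < n\<close> below the current
  state makes \<open>i\<close> the new state. (The state \<open>k\<close> means that \<open>\<rho>\<^sub>n\<^bsup>k\<^esup>\<close> remains available.)
  Right multiplication by generators induces a partial action on normal words, in which the only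
  rewriting is \<open>\<rho>\<^sub>j \<rho>\<^sub>n\<^bsup>j\<^esup> \<rho>\<^sub>i = \<rho>\<^bsub>i+j\<^esub> \<rho>\<^sub>n\<^bsup>j\<^esup>\<close>. This action respects the defining relations, including
  where it is undefined; as \<open>\<Delta>\<^sub>n\<close> acts on the empty word, so does each of its left divisors, and
  the result is its normal word. With \<open>N\<^sub>k\<close> the number of words accepted from state \<open>k \<le> n\<close>,
  \<open>N\<^sub>0 = 1\<close> and \<open>N\<^sub>k = 1 + N\<^bsub>k-1\<^esub> + N\<^sub>1 + \<dots> + N\<^bsub>k-1\<^esub>\<close>, which gives \<open>N\<^sub>k = F\<^bsub>2k-1\<^esub>\<close> and
  \<open>A\<^sub>n = 1 + N\<^sub>1 + \<dots> + N\<^sub>n = F\<^bsub>2n\<^esub>\<close>.\<close>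

section \<open>Counting the words accepted by the automaton\<close>

fun run :: "nat \<Rightarrow> nat \<Rightarrow> nat list \<Rightarrow> nat option" where
  "run n k [] = Some k"
| "run n k (a # w) =
    (if a = n then if k = 0 then None else run n (k - 1) w
     else if 1 \<le> a \<and> a < n \<and> a < k then run n a w else None)"

lemma run_append: "run n k (u @ v) = Option.bind (run n k u) (\<lambda>l. run n l v)"
  by (induction n k u rule: run.induct) auto

lemma run_replicate: "m \<le> k \<Longrightarrow> run n k (replicate m n) = Some (k - m)"
  by (induction m arbitrary: k) auto

lemma run_in_lists: "run n k w \<noteq> None \<Longrightarrow> 1 \<le> n \<Longrightarrow> w \<in> lists {1..n}"
  by (induction n k w rule: run.induct) (auto split: if_splits)

lemma card_Cons_image: "card ((#) a ` B) = card B"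
  by (simp add: card_image)

lemma run_words_0: "{w. run n 0 w \<noteq> None} = {[]}"
proof -
  have "run n 0 w \<noteq> None \<longleftrightarrow> w = []" for w by (cases w) auto
  then show ?thesis by auto
qed

text \<open>Split by the first letter. The \<open>min\<close> differs from \<open>Suc k\<close> only
  at \<open>k = n\<close>, where the letter \<open>n\<close> lies below the state
  \<open>n + 1\<close> but is already covered by the first image.\<close>

lemma run_words_decomp:
  assumes "k \<le> n"
  shows "{w. run n (Suc k) w \<noteq> None} = insert [] ((#) n ` {w. run n k w \<noteq> None} \<union>
     (\<Union>a\<in>{1..<min n (Suc k)}. (#) a ` {w. run n a w \<noteq> None}))" (is "?L = ?R")
proof (rule Set.set_eqI)
  show "w \<in> ?L \<longleftrightarrow> w \<in> ?R" for w
    by (cases w) (auto simp: image_iff)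
qed

lemma card_run_words_Suc:
  assumes "k \<le> n" "\<And>a. a \<le> k \<Longrightarrow> finite {w. run n a w \<noteq> None}"
  shows "finite {w. run n (Suc k) w \<noteq> None}"
    and "card {w. run n (Suc k) w \<noteq> None} = 1 + card {w. run n k w \<noteq> None} +
      (\<Sum>a\<in>{1..<min n (Suc k)}. card {w. run n a w \<noteq> None})"
proof -
  let ?Y = "\<lambda>a. {w. run n a w \<noteq> None}"
  let ?U = "\<Union>a\<in>{1..<min n (Suc k)}. (#) a ` ?Y a"
  have finY: "finite ((#) a ` ?Y b)" if "b \<le> k" for a b
    by (rule finite_imageI) (rule assms(2)[OF that])
  have finU: "finite ?U"
    by (rule finite_UN_I[OF finite_atLeastLessThan finY]) simp
  have cU: "card ?U = (\<Sum>a\<in>{1..<min n (Suc k)}. card (?Y a))"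
    by (subst card_UN_disjoint) (auto simp: card_Cons_image less_Suc_eq_le simp del: not_None_eq intro!: finY)
  have "card ((#) n ` ?Y k \<union> ?U) = card (?Y k) + card ?U"
    by (subst card_Un_disjoint[OF finY finU]) (auto simp: card_Cons_image)
  moreover have "[] \<notin> (#) n ` ?Y k \<union> ?U" by auto
  moreover have "finite ((#) n ` ?Y k \<union> ?U)" using finY finU by simp
  ultimately show "finite (?Y (Suc k))"
    "card (?Y (Suc k)) = 1 + card (?Y k) + (\<Sum>a\<in>{1..<min n (Suc k)}. card (?Y a))"
    unfolding run_words_decomp[OF assms(1)] cU[symmetric] by (simp_all only: card_insert_disjoint finite_insert plus_1_eq_Suc add_Suc
        simp_thms)
qed

text \<open>Telescoping of \<open>F (2 * k) - F (2 * k - 2) = F (2 * k - 1)\<close>, with initial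
  term \<open>F 0 = 1\<close>.\<close>

lemma sum_F_odd: "1 + (\<Sum>a\<in>{1..<Suc k}. F (2 * a - 1)) = F (2 * k)"
proof (induction k)
  case (Suc k)
  have "F (2 * Suc k) = F (2 * Suc k - 1) + F (2 * k)" by simp
  with Suc show ?case by (simp del: F.simps)
qed simp

lemma sum_F_even: "2 + (\<Sum>i = 1..k. F (2 * i)) = F (2 * k + 1)"
proof (induction k)
  case (Suc k)
  have "F (2 * Suc k + 1) = F (2 * Suc k) + F (2 * k + 1)" by simp
  with Suc show ?case by (simp del: F.simps)
qed simp

lemma card_run_words:
  assumes "k \<le> n"
  shows "finite {w. run n k w \<noteq> None} \<and>
    card {w. run n k w \<noteq> None} = (if k = 0 then 1 else F (2 * k - 1))"
  using assms
proof (induction k rule: less_induct)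
  case (less k)
  show ?case
  proof (cases k)
    case 0
    then show ?thesis using run_words_0[of n] by simp
  next
    case (Suc l)
    have IH: "finite {w. run n a w \<noteq> None}"
      "card {w. run n a w \<noteq> None} = (if a = 0 then 1 else F (2 * a - 1))" if "a \<le> l" for a
      using less.IH[of a] less.prems Suc that by auto
    have l: "l \<le> n" and m: "min n (Suc l) = Suc l" using Suc less.prems by auto
    have s: "(\<Sum>a\<in>{1..<Suc l}. card {w. run n a w \<noteq> None}) = (\<Sum>a\<in>{1..<Suc l}. F (2 * a - 1))"
      by (rule sum.cong) (use IH(2) in auto)
    \<comment> \<open>The empty word and the words starting below \<open>n\<close> contribute
      \<open>F (2 * l)\<close> together; the other summand counts the words starting with
      \<open>n\<close>.\<close>
    have "card {w. run n k w \<noteq> None} = card {w. run n l w \<noteq> None} + F (2 * l)"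
      using card_run_words_Suc(2)[OF l IH(1)] s sum_F_odd[of l] unfolding m Suc by linarith
    also have "\<dots> = F (2 * k - 1)"
      using IH(2)[of l] Suc by (cases l) auto
    finally show ?thesis
      using card_run_words_Suc(1)[OF l IH(1)] Suc by simp
  qed
qed

text \<open>From state \<open>n + 1\<close> the first letter leads to each of the states 1, ...,
  \<open>n\<close> exactly once, the letter \<open>n\<close> leading to state
  \<open>n\<close>.\<close>

lemma card_run_words_top:
  assumes "1 \<le> n"
  shows "card {w. run n (Suc n) w \<noteq> None} = F (2 * n)"
proof -
  have s: "(\<Sum>a\<in>{1..<n}. card {w. run n a w \<noteq> None}) = (\<Sum>a\<in>{1..<n}. F (2 * a - 1))"
    by (rule sum.cong) (use card_run_words in auto)
  have "card {w. run n (Suc n) w \<noteq> None} = 1 + F (2 * n - 1) + (\<Sum>a\<in>{1..<n}. F (2 * a - 1))"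
    using card_run_words_Suc(2)[of n n] card_run_words[of _ n] assms s by simp
  also have "\<dots> = 1 + (\<Sum>a\<in>{1..<Suc n}. F (2 * a - 1))"
    using assms by simp
  finally show ?thesis by (simp only: sum_F_odd)
qed

section \<open>Normal words as stacks and the partial action on them\<close>

text \<open>A stack \<open>[(j\<^sub>r, k\<^sub>r), \<dots>, (j\<^sub>1, k\<^sub>1), (n + 1, k\<^sub>0)]\<close> encodes the normal word
  \<open>n\<^bsup>n + 1 - k\<^sub>0\<^esup> j\<^sub>1 n\<^bsup>j\<^sub>1 - k\<^sub>1\<^esup> \<dots> j\<^sub>r n\<^bsup>j\<^sub>r - k\<^sub>r\<^esup>\<close>; the second components are the states of \<^const>\<open>run\<close>
  at the ends of the blocks.\<close>

fun word_of :: "nat \<Rightarrow> (nat \<times> nat) list \<Rightarrow> nat list" where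
  "word_of n [] = []"
| "word_of n [(j, k)] = replicate (j - k) n"
| "word_of n ((j, k) # p # s) = word_of n (p # s) @ j # replicate (j - k) n"

text \<open>The test \<open>j < k'\<close> lets the automaton read \<open>j\<close> in the state
  where the block below ended. The bottom block has no leading letter, so its \<open>j\<close> is
  the initial state.\<close>

fun valid :: "nat \<Rightarrow> (nat \<times> nat) list \<Rightarrow> bool" where
  "valid n [] = False"
| "valid n [(j, k)] = (j = n + 1 \<and> k \<le> j)"
| "valid n ((j, k) # (j', k') # s) =
    (1 \<le> j \<and> j < n \<and> j < k' \<and> k \<le> j \<and> valid n ((j', k') # s))"

text \<open>Right multiplication of a normal word by a generator, where defined. The last two
  successful cases use \<open>j n\<^sup>j i = (i + j) n\<^sup>j\<close>.\<close>

fun step :: "nat \<Rightarrow> (nat \<times> nat) list \<Rightarrow> nat \<Rightarrow> (nat \<times> nat) list option" where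
  "step n [] i = None"
| "step n ((j, k) # s) i =
    (if i = n then if k = 0 then None else Some ((j, k - 1) # s)
     else if i < k then Some ((i, i) # (j, k) # s)
     else if k = 0 then
       (case s of [] \<Rightarrow> None
        | (j', k') # s' \<Rightarrow>
          if i + j < n \<and> i + j < k' then Some ((i + j, i) # s)
          else if i + j = n then Some ((j', k' - (j + 1)) # s')
          else None)
     else None)"

fun steps :: "nat \<Rightarrow> (nat \<times> nat) list \<Rightarrow> nat list \<Rightarrow> (nat \<times> nat) list option" where
  "steps n t [] = Some t"
| "steps n t (i # w) = Option.bind (step n t i) (\<lambda>t'. steps n t' w)"

lemma steps_append: "steps n t (u @ v) = Option.bind (steps n t u) (\<lambda>t'. steps n t' v)"
  by (induction u arbitrary: t) (auto split: Option.bind_split)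

lemma valid_le: "valid n ((j, k) # s) \<Longrightarrow> k \<le> j \<and> j \<le> n + 1"
  by (cases s) auto

lemma valid_change: "valid n ((j, k) # s) \<Longrightarrow> k' \<le> k \<Longrightarrow> valid n ((j, k') # s)"
  by (cases s) auto

lemma step_cases:
  assumes "step n t i = Some t'"
  obtains (append_n) j k s where "t = (j, k) # s" "i = n" "0 < k" "t' = (j, k - 1) # s"
  | (append) j k s where "t = (j, k) # s" "i \<noteq> n" "i < k" "t' = (i, i) # (j, k) # s"
  | (merge) j j' k' s where "t = (j, 0) # (j', k') # s" "i + j < n" "i + j < k'"
      "t' = (i + j, i) # (j', k') # s"
  | (merge_n) j j' k' s where "t = (j, 0) # (j', k') # s" "i + j = n"
      "t' = (j', k' - (j + 1)) # s"
proof (cases t)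
  case Nil
  with assms show ?thesis by simp
next
  case (Cons p s)
  obtain j k where p: "p = (j, k)" by force
  consider "i = n" | "i \<noteq> n" "i < k" | "i \<noteq> n" "k = 0" | "i \<noteq> n" "\<not> i < k" "k \<noteq> 0"
    by blast
  then show ?thesis
  proof cases
    case 1
    with assms Cons p show ?thesis by (intro append_n[of j k s]) (auto split: if_splits)
  next
    case 2
    with assms Cons p show ?thesis by (intro append[of j k s]) auto
  next
    case 3
    with assms Cons p obtain q s' where s: "s = q # s'" by (cases s) auto
    obtain j' k' where "q = (j', k')" by force
    with 3 assms Cons p s show ?thesis
      using merge[of j j' k' s'] merge_n[of j j' k' s'] by (auto split: if_splits)
  next
    case 4
    with assms Cons p show ?thesis by simp
  qed
qed

lemma valid_step:
  assumes "valid n t" "step n t i = Some t'" "1 \<le> i" "i \<le> n"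
  shows "valid n t'"
  using assms(2)
proof (cases rule: step_cases)
  case (append_n j k s)
  with assms(1) show ?thesis using valid_change[of n j k s "k - 1"] by simp
next
  case (merge_n j j' k' s)
  with assms(1) show ?thesis using valid_change[of n j' k' s "k' - (j + 1)"] by simp
qed (use assms in auto)

lemma valid_steps:
  assumes "valid n t" "steps n t w = Some t'" "w \<in> lists {1..n}"
  shows "valid n t'"
  using assms
proof (induction w arbitrary: t)
  case (Cons i w)
  then obtain t1 where "step n t i = Some t1" "steps n t1 w = Some t'"
    by (auto split: Option.bind_splits)
  with Cons valid_step[of n t i t1] show ?case by auto
qed simp

text \<open>If the top state is positive, both sides open a block \<open>i + 1\<close> (or append
  \<open>n\<close> twice if \<open>i + 1 = n\<close>). If it is 0, both merge into the top block
  \<open>j\<close>, giving \<open>i + 1 + j\<close>. Otherwise both are undefined.\<close>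

lemma steps_relation:
  assumes t: "valid n t" and i: "1 \<le> i" "i < n"
  shows "steps n t [1, n, i] = steps n t [i + 1, n]"
proof -
  obtain j k s where [simp]: "t = (j, k) # s" using t by (cases t) auto
  show ?thesis
  proof (cases "k = 0")
    case False
    with t i show ?thesis by auto
  next
    case True
    show ?thesis
    proof (cases s)
      case Nil
      with True t i show ?thesis by auto
    next
      case (Cons p s')
      obtain j' k' where p: "p = (j', k')" by force
      have j: "1 \<le> j" "j < n" "j < k'" "k' \<le> n + 1"
        using t valid_le[of n j' k' s'] by (auto simp: Cons p)
      have bottom: "s' = []" if "n < k'"
        using t that by (cases s') (auto simp: Cons p)
      consider "i + 1 + j < n" | "i + 1 + j = n" | "n < i + 1 + j" "1 + j < n" | "1 + j = n"
        using j(2) by linarith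
      then show ?thesis
      proof cases
        case 1
        then show ?thesis using i j by (simp add: Cons p True)
      next
        case 2
        then show ?thesis using i j by (simp add: Cons p True)
      next
        case 3
        then show ?thesis using i j by (simp add: Cons p True)
      next
        \<comment> \<open>The right side is undefined at once. On the left, the letter 1 leaves the
          state \<open>k' - n\<close>, which is 0 or 1: either \<open>n\<close> fails next, or
          \<open>k' = n + 1\<close>, the block is the bottom one, and \<open>i\<close> fails in its
          state 0.\<close>
        case 4
        then show ?thesis using i j bottom by (cases "n < k'") (auto simp: Cons p True)
      qed
    qed
  qed
qed

lemma steps_word_cong:
  assumes "(u, v) \<in> word_cong {1..n} (rho_rels n)" "valid n t"
  shows "steps n t u = steps n t v"
  using assms
proof (induction arbitrary: t rule: word_cong.induct)
  case (rel u v p q)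
  then obtain i where i: "u = [1, n, i]" "v = [i + 1, n]" "1 \<le> i" "i < n"
    by (auto simp: rho_rels_def)
  have "steps n t' u = steps n t' v" if "valid n t'" for t'
    unfolding i(1,2) using steps_relation[OF that i(3,4)] .
  then show ?case
    using valid_steps[OF rel.prems _ rel.hyps(4)]
    by (cases "steps n t p") (auto simp: steps_append)
qed auto

section \<open>Agreement of the action with multiplication in the monoid\<close>

text \<open>Induction on \<open>j\<close>: a defining relation rewrites \<open>j + 1, n\<close> as
  \<open>1, n, j\<close>, the induction hypothesis moves \<open>i\<close> into \<open>j\<close>, and
  a defining relation for \<open>i + j\<close> absorbs \<open>1, n\<close>.\<close>

lemma word_cong_j_nj_i:
  assumes "1 \<le> i" "1 \<le> j" "i + j \<le> n"
  shows "(j # replicate j n @ [i], (i + j) # replicate j n) \<in> word_cong {1..n} (rho_rels n)"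
  using assms(2,3)
proof (induction j rule: dec_induct)
  case base
  then have "([] @ [1, n, i] @ [], [] @ [i + 1, n] @ []) \<in> word_cong {1..n} (rho_rels n)"
    using assms(1) by (intro word_cong.rel) (auto simp: rho_rels_def)
  then show ?case by simp
next
  case (step j)
  let ?C = "word_cong {1..n} (rho_rels n)"
  have R: "([] @ [1, n, l] @ replicate j n @ q, [] @ [l + 1, n] @ replicate j n @ q) \<in> ?C"
    if "1 \<le> l" "l < n" "q \<in> lists {1..n}" for l q
    using that by (intro word_cong.rel) (auto simp: rho_rels_def)
  have "([1, n] @ (j # replicate j n @ [i]) @ [], [1, n] @ ((i + j) # replicate j n) @ []) \<in> ?C"
    using step assms(1) by (intro word_cong_context) auto
  moreover have "(Suc j # replicate (Suc j) n @ [i], [1, n] @ j # replicate j n @ [i]) \<in> ?C"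
    using word_cong.sym[OF R[of j "[i]"]] step assms(1) by simp
  moreover have "([1, n] @ (i + j) # replicate j n, (i + Suc j) # replicate (Suc j) n) \<in> ?C"
    using R[of "i + j" "[]"] step assms(1) by simp
  ultimately show ?case
    by (auto intro: word_cong.trans)
qed

lemma word_of_diff:
  assumes "m \<le> k" "k \<le> j"
  shows "word_of n ((j, k - m) # s) = word_of n ((j, k) # s) @ replicate m n"
proof -
  have "j - (k - m) = (j - k) + m" using assms by simp
  then show ?thesis by (cases s) (simp_all add: replicate_add)
qed

lemma run_word_of:
  "valid n ((j, k) # s) \<Longrightarrow> run n (n + 1) (word_of n ((j, k) # s)) = Some k"
proof (induction s arbitrary: j k)
  case Nil
  then show ?case by (simp add: run_replicate)
next
  case (Cons p s)
  obtain j' k' where [simp]: "p = (j', k')" by force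
  with Cons show ?case by (simp add: run_append run_replicate)
qed

lemma word_of_in_lists:
  assumes "valid n t" "1 \<le> n"
  shows "word_of n t \<in> lists {1..n}"
proof -
  obtain j k s where "t = (j, k) # s" using assms(1) by (cases t) auto
  with run_word_of[of n j k s] assms(1) have "run n (n + 1) (word_of n t) \<noteq> None" by simp
  from run_in_lists[OF this assms(2)] show ?thesis .
qed

lemma word_cong_step:
  assumes t: "valid n t" "step n t i = Some t'" and i: "1 \<le> i" "i \<le> n"
  shows "(word_of n t @ [i], word_of n t') \<in> word_cong {1..n} (rho_rels n)"
proof -
  let ?C = "word_cong {1..n} (rho_rels n)"
  have wt: "word_of n t @ [i] \<in> lists {1..n}"
    using word_of_in_lists[OF t(1)] i by auto
  note refl = word_cong.refl[OF wt, of "rho_rels n"]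
  from t(2) show ?thesis
  proof (cases rule: step_cases)
    case (append_n j k s)
    then have "word_of n t' = word_of n t @ [i]"
      using word_of_diff[of 1 k j n s] valid_le t(1) by simp
    with refl show ?thesis by simp
  next
    case (append j k s)
    then have "word_of n t' = word_of n t @ [i]" by simp
    with refl show ?thesis by simp
  next
    case (merge j j' k' s)
    let ?u = "word_of n ((j', k') # s)"
    from merge t have j: "1 \<le> j" and v: "valid n ((j', k') # s)" by auto
    have "(?u @ (j # replicate j n @ [i]) @ [], ?u @ ((i + j) # replicate j n) @ []) \<in> ?C"
      using merge j i word_of_in_lists[OF v] by (intro word_cong_context word_cong_j_nj_i) auto
    with merge show ?thesis by simp
  next
    case (merge_n j j' k' s)
    let ?u = "word_of n ((j', k') # s)"
    from merge_n t have j: "1 \<le> j" "j < k'" and v: "valid n ((j', k') # s)" by auto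
    have "(?u @ (j # replicate j n @ [i]) @ [], ?u @ ((i + j) # replicate j n) @ []) \<in> ?C"
      using merge_n j i word_of_in_lists[OF v] by (intro word_cong_context word_cong_j_nj_i) auto
    \<comment> \<open>As \<open>i + j = n\<close>, the merged block is a pure power of
      \<open>n\<close>, which extends the block below.\<close>
    moreover have "word_of n t' = ?u @ replicate (j + 1) n"
      using word_of_diff[of "j + 1" k' j' n s] valid_le[OF v] j merge_n by simp
    ultimately show ?thesis using merge_n by simp
  qed
qed

lemma word_cong_steps:
  assumes "valid n t" "steps n t w = Some t'" "w \<in> lists {1..n}" "1 \<le> n"
  shows "(word_of n t @ w, word_of n t') \<in> word_cong {1..n} (rho_rels n)"
  using assms
proof (induction w arbitrary: t)
  case Nil
  then show ?case using word_of_in_lists by (auto intro: word_cong.refl)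
next
  case (Cons i w)
  then obtain t1 where t1: "step n t i = Some t1" "steps n t1 w = Some t'"
    by (auto split: Option.bind_splits)
  have i: "1 \<le> i" "i \<le> n" "w \<in> lists {1..n}" using Cons by auto
  have "([] @ (word_of n t @ [i]) @ w, [] @ word_of n t1 @ w) \<in> word_cong {1..n} (rho_rels n)"
    using word_cong_step[OF Cons.prems(1) t1(1) i(1,2)] i(3) by (intro word_cong_context) auto
  moreover have "(word_of n t1 @ w, word_of n t') \<in> word_cong {1..n} (rho_rels n)"
    using Cons.IH[OF valid_step[OF Cons.prems(1) t1(1) i(1,2)] t1(2) i(3)] Cons.prems by simp
  ultimately show ?case by (auto intro: word_cong.trans)
qed

text \<open>Along an accepted word only the two appending cases of \<open>step\<close> occur, so
  nothing is rewritten.\<close>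

lemma steps_run:
  assumes "valid n ((j, k) # s)" "run n k w \<noteq> None"
  shows "\<exists>t. steps n ((j, k) # s) w = Some t \<and> word_of n t = word_of n ((j, k) # s) @ w"
  using assms
proof (induction w arbitrary: j k s)
  case (Cons a w)
  show ?case
  proof (cases "a = n")
    case True
    with Cons.prems have "0 < k" "valid n ((j, k - 1) # s)" "run n (k - 1) w \<noteq> None"
      using valid_change[of n j k s "k - 1"] by (auto split: if_splits)
    with Cons.IH[of j "k - 1" s] True valid_le[OF Cons.prems(1)] word_of_diff[of 1 k j n s]
    show ?thesis by simp
  next
    case False
    with Cons.prems have "a < k" "valid n ((a, a) # (j, k) # s)" "run n a w \<noteq> None"
      by (auto split: if_splits)
    with Cons.IH[of a a "(j, k) # s"] False show ?thesis by simp
  qed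
qed simp

section \<open>Left divisors of \<open>Delta n\<close> as classes of accepted words\<close>

lemma run_word_divides:
  assumes "run n (n + 1) w = Some k" "1 \<le> n"
  shows "\<exists>c\<in>lists {1..n}. (w @ replicate k n @ c, replicate (n + 1) n)
    \<in> word_cong {1..n} (rho_rels n)"
  using assms(1)
proof (induction w arbitrary: k rule: rev_induct)
  case Nil
  have "([] @ replicate k n @ [], replicate (n + 1) n) \<in> word_cong {1..n} (rho_rels n)"
    using Nil assms(2) by (auto intro!: word_cong.refl)
  then show ?case by blast
next
  case (snoc a w)
  let ?C = "word_cong {1..n} (rho_rels n)"
  obtain l where l: "run n (n + 1) w = Some l" "run n l [a] = Some k"
    using snoc.prems by (auto simp: run_append split: Option.bind_splits)
  obtain c where c: "c \<in> lists {1..n}" "(w @ replicate l n @ c, replicate (n + 1) n) \<in> ?C"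
    using snoc.IH[OF l(1)] by blast
  have w: "w \<in> lists {1..n}" using run_in_lists[of n "n + 1" w] l assms by auto
  show ?case
  proof (cases "a = n")
    case True
    with l have "replicate l n = n # replicate k n" by (cases l) auto
    with c True show ?thesis by auto
  next
    case False
    with l have a: "k = a" "1 \<le> a" "a < n" "a < l" by (auto split: if_splits)
    \<comment> \<open>The new cofactor is \<open>(n - a) # ?q\<close>: since \<open>a\<close>,
      followed by \<open>a\<close> letters \<open>n\<close> and by \<open>n - a\<close>, equals
      \<open>a + 1\<close> letters \<open>n\<close>, the old product is restored.\<close>
    let ?q = "replicate (l - (a + 1)) n @ c"
    have "(w @ (a # replicate a n @ [n - a]) @ ?q, w @ ((n - a + a) # replicate a n) @ ?q) \<in> ?C"
      using a w c(1) assms(2) by (intro word_cong_context word_cong_j_nj_i) auto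
    moreover have "replicate l n = n # replicate a n @ replicate (l - (a + 1)) n"
      using a by (simp flip: replicate_add replicate_Suc)
    ultimately have "((w @ [a]) @ replicate k n @ ((n - a) # ?q), replicate (n + 1) n) \<in> ?C"
      using a c(2) by (auto intro: word_cong.trans)
    moreover have "(n - a) # ?q \<in> lists {1..n}" using a c(1) by auto
    ultimately show ?thesis by blast
  qed
qed

lemma Delta_eq:
  assumes "1 \<le> n"
  shows "Delta n = word_cong {1..n} (rho_rels n) `` {replicate (n + 1) n}"
proof -
  have "rho n n [^]\<^bsub>M n\<^esub> m = word_cong {1..n} (rho_rels n) `` {replicate m n}" for m
  proof (induction m)
    case 0
    then show ?case by (simp add: M_def presented_monoid_def)
  next
    case (Suc m)
    interpret monoid "M n" unfolding M_def by (rule monoid_presented_monoid)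
    show ?case
      using Suc assms presented_monoid_mult[of "replicate m n" "{1..n}" "[n]" "rho_rels n"]
      by (simp add: rho_def M_def replicate_append_same in_lists_conv_set)
  qed
  moreover have "Delta n = rho n n [^]\<^bsub>M n\<^esub> (n + 1)"
    using assms by (simp only: Delta_def) simp
  ultimately show ?thesis by (simp only:)
qed

lemma carrier_M: "carrier (M n) = (\<lambda>w. word_cong {1..n} (rho_rels n) `` {w}) ` lists {1..n}"
  by (auto simp: M_def presented_monoid_def quotient_def)

lemma M_mult:
  assumes "u \<in> lists {1..n}" "v \<in> lists {1..n}"
  shows "word_cong {1..n} (rho_rels n) `` {u} \<otimes>\<^bsub>M n\<^esub> word_cong {1..n} (rho_rels n) `` {v}
    = word_cong {1..n} (rho_rels n) `` {u @ v}"
  unfolding M_def using assms by (rule presented_monoid_mult)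

lemma class_divides_class:
  assumes u: "u \<in> lists {1..n}" and v: "v \<in> lists {1..n}"
  shows "word_cong {1..n} (rho_rels n) `` {u} divides\<^bsub>M n\<^esub> word_cong {1..n} (rho_rels n) `` {v}
    \<longleftrightarrow> (\<exists>c\<in>lists {1..n}. (u @ c, v) \<in> word_cong {1..n} (rho_rels n))"
proof -
  have "word_cong {1..n} (rho_rels n) `` {v} =
      word_cong {1..n} (rho_rels n) `` {u} \<otimes>\<^bsub>M n\<^esub> word_cong {1..n} (rho_rels n) `` {c}
    \<longleftrightarrow> (u @ c, v) \<in> word_cong {1..n} (rho_rels n)" if "c \<in> lists {1..n}" for c
    unfolding M_mult[OF u that]
    using eq_equiv_class_iff[OF equiv_word_cong, of "u @ c" "{1..n}" v "rho_rels n"] u v that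
    by (metis append_in_lists_conv)
  then show ?thesis
    unfolding factor_def carrier_M by (simp cong: bex_cong)
qed

lemma Div_Delta_eq:
  assumes n: "1 \<le> n"
  shows "Div_Delta n = (\<lambda>w. word_cong {1..n} (rho_rels n) `` {w}) ` {w. run n (n + 1) w \<noteq> None}"
    (is "_ = ?cl ` ?Y")
proof
  let ?t0 = "[(n + 1, n + 1)]" and ?D = "replicate (n + 1) n"
  let ?C = "word_cong {1..n} (rho_rels n)"
  have D: "?D \<in> lists {1..n}" using n by auto
  show "?cl ` ?Y \<subseteq> Div_Delta n"
  proof (rule image_subsetI)
    fix w assume "w \<in> ?Y"
    then obtain k where k: "run n (n + 1) w = Some k" by blast
    then have w: "w \<in> lists {1..n}" using run_in_lists n by blast
    obtain c where "c \<in> lists {1..n}" "(w @ replicate k n @ c, ?D) \<in> ?C"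
      using run_word_divides[OF k n] by blast
    then have "\<exists>c\<in>lists {1..n}. (w @ c, ?D) \<in> ?C"
      using n by (intro bexI[of _ "replicate k n @ c"]) auto
    then show "?cl w \<in> Div_Delta n"
      unfolding Div_Delta_def Delta_eq[OF n]
      using class_divides_class[OF w D] w by (auto simp: carrier_M)
  qed
  show "Div_Delta n \<subseteq> ?cl ` ?Y"
  proof
    fix a assume a: "a \<in> Div_Delta n"
    then obtain w where w: "w \<in> lists {1..n}" "a = ?cl w"
      by (auto simp: Div_Delta_def carrier_M)
    with a obtain c where c: "c \<in> lists {1..n}" "(w @ c, ?D) \<in> ?C"
      using class_divides_class[OF w(1) D] by (auto simp: Div_Delta_def Delta_eq[OF n])
    \<comment> \<open>\<open>?t0\<close> encodes the empty word. The action of \<open>?D\<close> on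
      it is defined, hence so is that of the congruent \<open>w @ c\<close> and of its prefix
      \<open>w\<close>.\<close>
    have "steps n ?t0 ?D \<noteq> None"
      using steps_run[of n "n + 1" "n + 1" "[]" ?D] run_replicate[of "n + 1" "n + 1" n] by auto
    then have "steps n ?t0 (w @ c) \<noteq> None"
      using steps_word_cong[OF c(2), of ?t0] by simp
    then obtain t where t: "steps n ?t0 w = Some t"
      by (auto simp: steps_append split: Option.bind_splits)
    have "(w, word_of n t) \<in> ?C"
      using word_cong_steps[OF _ t w(1) n] by simp
    then have "a = ?cl (word_of n t)"
      using w equiv_class_eq[OF equiv_word_cong] by blast
    moreover have "word_of n t \<in> ?Y"
      using valid_steps[OF _ t w(1)] run_word_of[of n] by (cases t) auto
    ultimately show "a \<in> ?cl ` ?Y" by blast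
  qed
qed

text \<open>Congruent words act alike, and an accepted word acting on the empty word returns itself,
  so its class determines it.\<close>

lemma inj_on_run_words:
  assumes n: "1 \<le> n"
  shows "inj_on (\<lambda>w. word_cong {1..n} (rho_rels n) `` {w}) {w. run n (n + 1) w \<noteq> None}"
proof (rule inj_onI)
  let ?t0 = "[(n + 1, n + 1)]"
  fix u v
  assume uv: "u \<in> {w. run n (n + 1) w \<noteq> None}" "v \<in> {w. run n (n + 1) w \<noteq> None}"
    and eq: "word_cong {1..n} (rho_rels n) `` {u} = word_cong {1..n} (rho_rels n) `` {v}"
  have "u \<in> lists {1..n}" "v \<in> lists {1..n}"
    using uv run_in_lists[OF _ n] by simp_all
  with eq have "(u, v) \<in> word_cong {1..n} (rho_rels n)"
    using eq_equiv_class_iff[OF equiv_word_cong] by metis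
  then have "steps n ?t0 u = steps n ?t0 v"
    by (rule steps_word_cong) simp
  with uv show "u = v"
    using steps_run[of n "n + 1" "n + 1" "[]" u] steps_run[of n "n + 1" "n + 1" "[]" v] by auto
qed

lemma Div_Delta_0: "Div_Delta 0 = {\<one>\<^bsub>M 0\<^esub>}"
proof -
  interpret monoid "M 0" unfolding M_def by (rule monoid_presented_monoid)
  have "carrier (M 0) = {\<one>\<^bsub>M 0\<^esub>}"
    unfolding carrier_M by (simp add: M_def presented_monoid_def)
  then show ?thesis by (auto simp: Div_Delta_def Delta_def intro: dividesI)
qed

section \<open>Fibonacci formula and recurrence\<close>

lemma A_eq_F: "A n = F (2 * n)"
proof (cases "n = 0")
  case True
  then show ?thesis by (simp add: A_def Div_Delta_0)
next
  case False
  then have "1 \<le> n" by simp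
  from card_image[OF inj_on_run_words[OF this]] card_run_words_top[OF this] show ?thesis
    by (simp add: A_def Div_Delta_eq[OF \<open>1 \<le> n\<close>])
qed

theorem corollary4p1:
  shows "(\<forall>n\<ge>2. A n = 2 * A 0 + 2 * A (n - 1) + (\<Sum>i = 1..n - 2. A i))
    \<and> (\<forall>n. A n = F (2 * n))"
proof (intro conjI allI impI A_eq_F)
  fix n :: nat assume "2 \<le> n"
  then obtain m where n: "n = m + 2" using le_Suc_ex by (metis add.commute)
  \<comment> \<open>The remaining \<open>F (2 * m + 1)\<close> is the sum of the \<open>A i\<close>
    plus 2, and this 2 is \<open>2 * A 0\<close>.\<close>
  have "F (2 * (m + 2)) = 2 * F (2 * (m + 1)) + F (2 * m + 1)" by simp
  with sum_F_even[of m] show "A n = 2 * A 0 + 2 * A (n - 1) + (\<Sum>i = 1..n - 2. A i)"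
    unfolding A_eq_F n by (simp del: F.simps(3))
qed

end
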